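(* Let $\mathbf{m},\mathbf{m}',\mathbf{n},\mathbf{n}'\in\Sigma$. Let $T$ and $T'$ be isometries of $\mathbb{R}^n$ such that $\mu$ is invariant under $T$ and $\mu'$ is invariant under $T'$. Suppose there exists $\varrho>0$ such that $$\left|s_{\mathbf{m}}\big(T(s_{\mathbf{n}}^{-1}(x))\big)-s_{\mathbf{m}'}\big(T'(s_{\mathbf{n}'}^{-1}(y))\big)\right|=\varrho\,|x-y|\qquad\text{for all }x,y\in\mathbb{R}^n.$$ Then $$I_{\mathbf{m},\mathbf{m}'}=\begin{cases}\displaystyle\frac{p_{\mathbf{m}}\,p'_{\mathbf{m}'}}{p_{\mathbf{n}}\,p'_{\mathbf{n}'}}\,\varrho^{-t}\,I_{\mathbf{n},\mathbf{n}'}, & t\in(0,t_* ),\\[4mm]\displaystyle p_{\mathbf{m}}\,p'_{\mathbf{m}'}\left(\mu(\Gamma)\,\mu'(\Gamma)\log\varrho+\frac{1}{p_{\mathbf{n}}\,p'_{\mathbf{n}'}}\,I_{\mathbf{n},\mathbf{n}'}\right), & t=0.\end{cases}$$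
   Context: Setting. Let $n\ge 1$, $M\ge 2$ be integers and let $\{s_1,\ldots,s_M\}$ be an iterated function system (IFS) of contracting similarities of $\mathbb{R}^n$: for each $m$, $s_m(x)=\rho_mA_mx+\delta_m$ with $\rho_m\in(0,1)$, $A_m\in\mathbb{R}^{n\times n}$ orthogonal and $\delta_m\in\mathbb{R}^n$. The IFS is assumed to satisfy the open set condition: there is a non-empty bounded open set $O\subset\mathbb{R}^n$ with $\bigcup_{m=1}^M s_m(O)\subset O$ and $s_m(O)\cap s_{m'}(O)=\emptyset$ for $m\ne m'$. $\Gamma$ denotes the attractor, i.e. the unique non-empty compact set with $\Gamma=\bigcup_{m=1}^M s_m(\Gamma)$. Self-similar measures. Given weights $p_1,\ldots,p_M\in(0,1)$ with $\sum_m p_m=1$, a self-similar measure on $\Gamma$ with these weights is a (non-zero) positive finite Borel-regular measure $\mu$ supported on $\Gamma$ with $\mu(E)=\sum_{m=1}^M p_m\,\mu(s_m^{-1}(E))$ for every measurable $E\subset\mathbb{R}^n$ (it exists and is unique up to normalisation). $\mu$ and $\mu'$ are self-similar measures on $\Gamma$ with weights $(p_1,\ldots,p_M)$ and $(p_1',\ldots,p_M')$ respectively. Indices. $\Sigma:=\{\emptyset\}\cup\bigcup_{\ell\ge1}\{1,\ldots,M\}^\ell$. For $\mathbf{m}=(m_1,\ldots,m_\ell)\in\Sigma$ set $s_{\mathbf{m}}:=s_{m_1}\circ\cdots\circ s_{m_\ell}$, $\Gamma_{\mathbf{m}}:=s_{\mathbf{m}}(\Gamma)$, $p_{\mathbf{m}}:=\prod_{i=1}^\ell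 p_{m_i}$ and $p'_{\mathbf{m}}:=\prod_{i=1}^\ell p'_{m_i}$, with $s_\emptyset$ the identity map, $\Gamma_\emptyset=\Gamma$ and $p_\emptyset=p'_\emptyset=1$. (Bold $\mathbf{n},\mathbf{n}'$ denote indices in $\Sigma$, not to be confused with the dimension $n$.) Invariance. An isometry $T:\mathbb{R}^n\to\mathbb{R}^n$ has the form $T(x)=A_Tx+\delta_T$ with $A_T$ orthogonal and $\delta_T\in\mathbb{R}^n$. A measure $\mu$ is invariant under $T$ if $\mu(T(E))=\mu(E)$ for all measurable $E\subset\mathbb{R}^n$. Kernel and sub-integrals. For $t\ge 0$ and $x,y\in\mathbb{R}^n$, $\Phi_t(x,y):=|x-y|^{-t}$ if $t>0$ and $\Phi_0(x,y):=\log|x-y|$. For $\mathbf{m},\mathbf{m}'\in\Sigma$ (possibly of different lengths), $$I_{\mathbf{m},\mathbf{m}'}:=\int_{\Gamma_{\mathbf{m}}}\left(\int_{\Gamma_{\mathbf{m}'}}\Phi_t(x,y)\,\mathrm{d}\mu'(y)\right)\mathrm{d}\mu(x).$$ The number $t_*>0$ (assumed to exist) is the largest positive real number such that the integral $I_{\emptyset,\emptyset}=\int_\Gamma\int_\Gamma\Phi_t(x,y)\,\mathrm{d}\mu'(y)\,\mathrm{d}\mu(x)$ converges for all $0\le t<t_*$. *)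

theory Defs
  imports "HOL-Analysis.Analysis"
begin

definition is_isometry :: "(real ^ 'n \<Rightarrow> real ^ 'n) \<Rightarrow> bool" where
  "is_isometry T \<longleftrightarrow> (\<exists>A d. orthogonal_matrix A \<and> T = (\<lambda>x. A *v x + d))"

definition contracting_similarity :: "(real ^ 'n \<Rightarrow> real ^ 'n) \<Rightarrow> bool" where
  "contracting_similarity f \<longleftrightarrow>
     (\<exists>\<rho> A d. 0 < \<rho> \<and> \<rho> < 1 \<and> orthogonal_matrix A \<and> f = (\<lambda>x. \<rho> *\<^sub>R (A *v x) + d))"

text \<open>Only the values \<open>s 1, \<dots>, s M\<close> of the family \<open>s\<close> are relevant; likewise for the weights below.\<close>

definition similarity_ifs :: "nat \<Rightarrow> (nat \<Rightarrow> real ^ 'n \<Rightarrow> real ^ 'n) \<Rightarrow> bool" where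
  "similarity_ifs M s \<longleftrightarrow> 2 \<le> M \<and> (\<forall>m\<in>{1..M}. contracting_similarity (s m))"

definition open_set_condition :: "nat \<Rightarrow> (nat \<Rightarrow> real ^ 'n \<Rightarrow> real ^ 'n) \<Rightarrow> bool" where
  "open_set_condition M s \<longleftrightarrow>
     (\<exists>U. U \<noteq> {} \<and> bounded U \<and> open U \<and> (\<Union>m\<in>{1..M}. s m ` U) \<subseteq> U \<and>
          disjoint_family_on (\<lambda>m. s m ` U) {1..M})"

definition is_attractor ::
    "nat \<Rightarrow> (nat \<Rightarrow> real ^ 'n \<Rightarrow> real ^ 'n) \<Rightarrow> (real ^ 'n) set \<Rightarrow> bool" where
  "is_attractor M s \<Gamma> \<longleftrightarrow> \<Gamma> \<noteq> {} \<and> compact \<Gamma> \<and> \<Gamma> = (\<Union>m\<in>{1..M}. s m ` \<Gamma>)"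

definition is_weights :: "nat \<Rightarrow> (nat \<Rightarrow> real) \<Rightarrow> bool" where
  "is_weights M p \<longleftrightarrow> (\<forall>m\<in>{1..M}. 0 < p m \<and> p m < 1) \<and> (\<Sum>m=1..M. p m) = 1"

text \<open>Measures live on the Borel sigma-algebra. A Borel-regular measure is determined by its
  restriction to the Borel sets, and every finite Borel measure on \<open>real ^ 'n\<close> arises in this way,
  so no separate regularity condition is needed.\<close>

definition self_similar_measure ::
    "nat \<Rightarrow> (nat \<Rightarrow> real ^ 'n \<Rightarrow> real ^ 'n) \<Rightarrow> (real ^ 'n) set \<Rightarrow> (nat \<Rightarrow> real) \<Rightarrow>
     (real ^ 'n) measure \<Rightarrow> bool" where
  "self_similar_measure M s \<Gamma> p \<mu> \<longleftrightarrow>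
     sets \<mu> = sets borel \<and> finite_measure \<mu> \<and> emeasure \<mu> UNIV \<noteq> 0 \<and> emeasure \<mu> (- \<Gamma>) = 0 \<and>
     (\<forall>E\<in>sets borel. emeasure \<mu> E = (\<Sum>m=1..M. ennreal (p m) * emeasure \<mu> (s m -` E)))"

definition invariant_under :: "(real ^ 'n) measure \<Rightarrow> (real ^ 'n \<Rightarrow> real ^ 'n) \<Rightarrow> bool" where
  "invariant_under \<mu> T \<longleftrightarrow> (\<forall>E\<in>sets \<mu>. emeasure \<mu> (T ` E) = emeasure \<mu> E)"

definition words :: "nat \<Rightarrow> nat list set" where
  "words M = lists {1..M}"

definition word_map :: "(nat \<Rightarrow> 'a \<Rightarrow> 'a) \<Rightarrow> nat list \<Rightarrow> 'a \<Rightarrow> 'a" where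
  "word_map s w = foldr (\<circ>) (map s w) id"

definition word_weight :: "(nat \<Rightarrow> real) \<Rightarrow> nat list \<Rightarrow> real" where
  "word_weight p w = prod_list (map p w)"

text \<open>The kernel is extended-real valued because it is infinite on the diagonal.\<close>

definition kernel :: "real \<Rightarrow> 'a::real_normed_vector \<Rightarrow> 'a \<Rightarrow> ereal" where
  "kernel t x y =
     (if t = 0 then (if x = y then -\<infinity> else ereal (ln (norm (x - y))))
      else (if x = y then \<infinity> else ereal (norm (x - y) powr - t)))"

text \<open>The Lebesgue integral of an extended-real function, as the integral of the positive part
  minus that of the negative part; \<open>e2ennreal\<close> sends negative arguments to \<open>0\<close>.
  In the undefined case \<open>\<infinity> - \<infinity>\<close> the value is \<open>\<infinity>\<close>, hence not finite.\<close>

definition ext_integral :: "'a measure \<Rightarrow> 'a set \<Rightarrow> ('a \<Rightarrow> ereal) \<Rightarrow> ereal" where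
  "ext_integral \<mu> B f =
     enn2ereal (\<integral>\<^sup>+x\<in>B. e2ennreal (f x) \<partial>\<mu>) - enn2ereal (\<integral>\<^sup>+x\<in>B. e2ennreal (- f x) \<partial>\<mu>)"

definition sub_integral ::
    "(nat \<Rightarrow> real ^ 'n \<Rightarrow> real ^ 'n) \<Rightarrow> (real ^ 'n) set \<Rightarrow> (real ^ 'n) measure \<Rightarrow>
     (real ^ 'n) measure \<Rightarrow> real \<Rightarrow> nat list \<Rightarrow> nat list \<Rightarrow> ereal" where
  "sub_integral s \<Gamma> \<mu> \<mu>' t w w' =
     ext_integral \<mu> (word_map s w ` \<Gamma>)
       (\<lambda>x. ext_integral \<mu>' (word_map s w' ` \<Gamma>) (\<lambda>y. kernel t x y))"

definition is_critical_exponent ::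
    "(nat \<Rightarrow> real ^ 'n \<Rightarrow> real ^ 'n) \<Rightarrow> (real ^ 'n) set \<Rightarrow> (real ^ 'n) measure \<Rightarrow>
     (real ^ 'n) measure \<Rightarrow> real \<Rightarrow> bool" where
  "is_critical_exponent s \<Gamma> \<mu> \<mu>' r \<longleftrightarrow>
     (let S = {u. 0 < u \<and> (\<forall>t. 0 \<le> t \<and> t < u \<longrightarrow> \<bar>sub_integral s \<Gamma> \<mu> \<mu>' t [] []\<bar> \<noteq> \<infinity>)}
      in r \<in> S \<and> (\<forall>u\<in>S. u \<le> r))"

end

theory Submission
  imports Defs "HOL-Library.Sublist"
begin

text \<open>
Write \<open>K\<^sub>w = word_map s w ` \<Gamma>\<close> for the cylinder of a word \<open>w\<close>. The heart of the matter is that a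
self-similar measure satisfies
\<open>\<mu> (E \<inter> K\<^sub>w) = word_weight p w * \<mu> (word_map s w -` E)\<close>, so that an integral over \<open>K\<^sub>w\<close> is a multiple
of an integral of the function composed with \<open>word_map s w\<close>; by invariance an isometry \<open>T\<close>
may be inserted for free (\<open>nn_integral_cylinder\<close>). Both double integrals of the theorem thereby
become multiples of double integrals over the whole space (\<open>sub_integral_pullback\<close>), with integrands
\<open>kernel t (word_map s w (T x)) (word_map s w' (T' y))\<close> and
\<open>kernel t (word_map s v x) (word_map s v' y)\<close>. The hypothesis on norms says exactly that the
distance of the first pair of points is \<open>r\<close> times the distance of the second pair, so the kernels differ by
the factor \<open>r powr - t\<close>, or by the summand \<open>ln r\<close> if \<open>t = 0\<close>.

The measure of \<open>E \<inter> K\<^sub>w\<close> is as claimed because first-level cylinders overlap in null sets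
(\<open>overlap_null\<close>), and this is where the open set condition enters. The argument
is a variant of the one by which Bandt, Graf and Schief obtain the strong open set condition. Call
\<open>v\<close> a neighbour of \<open>w\<close> if \<open>K\<^sub>v\<close> meets \<open>K\<^sub>w\<close> and \<open>v\<close> is
cut off at the first moment when its contraction ratio is at most that of \<open>w\<close>. Neighbours of \<open>w\<close> correspond
to disjoint copies of the open set of size comparable to \<open>K\<^sub>w\<close> and near it, so their number is bounded
independently of \<open>w\<close> (\<open>card_neighbours_bounded\<close>). If \<open>w\<close> has as many neighbours as
possible, then for every nonempty word \<open>u\<close> the neighbours of \<open>u @ w\<close> are just the words \<open>u @ v\<close> for
neighbours \<open>v\<close> of \<open>w\<close>. In particular all of them begin with the first letter of \<open>u\<close>, so
\<open>K\<^bsub>u @ w\<^esub>\<close> meets no first-level cylinder but its own (\<open>isolated_word_exists\<close>). Hence the code of a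
point in an overlap cannot contain the word \<open>w\<close> after its first letter, and almost every code
contains it (\<open>avoiding_word_null\<close>).

For \<open>t = 0\<close> the kernel takes both signs. It is bounded above on the compact attractor, so the integrals
of positive parts are finite and adding a constant to the integrand is legitimate even where an
integral is \<open>-\<infinity>\<close> (\<open>ext_integral_add_const\<close>).
\<close>

section \<open>Words\<close>

lemma word_map_Nil [simp]: "word_map s [] = id"
  and word_map_Cons [simp]: "word_map s (m # w) = s m \<circ> word_map s w"
  and word_map_append: "word_map s (v @ w) = word_map s v \<circ> word_map s w"
proof -
  show "word_map s [] = id" and "word_map s (m # w) = s m \<circ> word_map s w" for m w
    by (simp_all add: word_map_def)
  show "word_map s (v @ w) = word_map s v \<circ> word_map s w"
    by (induction v) (simp_all add: word_map_def comp_assoc)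
qed

lemma word_weight_simps [simp]:
  "word_weight p [] = 1"
  "word_weight p (m # w) = p m * word_weight p w"
  "word_weight p (v @ w) = word_weight p v * word_weight p w"
  by (simp_all add: word_weight_def)

lemma words_simps [simp]:
  "[] \<in> words M"
  "m # w \<in> words M \<longleftrightarrow> m \<in> {1..M} \<and> w \<in> words M"
  "v @ w \<in> words M \<longleftrightarrow> v \<in> words M \<and> w \<in> words M"
  by (auto simp: words_def)

section \<open>Cylinders under the open set condition\<close>

text \<open>A cover of \<open>K\<close> by finitely many balls of radius \<open>\<delta> / 2\<close> has at most one of the points in each
  ball. The bound does not depend on the family, and this uniformity is what
  \<open>card_neighbours_bounded\<close> exploits.\<close>

lemma separated_subset_card_bound:
  fixes K :: "'a::metric_space set"
  assumes "compact K" "0 < \<delta>"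
  shows "\<exists>N. \<forall>(I :: 'b set) f. f ` I \<subseteq> K \<and> (\<forall>i\<in>I. \<forall>j\<in>I. i \<noteq> j \<longrightarrow> \<delta> \<le> dist (f i) (f j)) \<longrightarrow>
           finite I \<and> card I \<le> N"
proof -
  from assms obtain k where k: "finite k" "K \<subseteq> (\<Union>x\<in>k. ball x (\<delta> / 2))"
    using compact_eq_totally_bounded[of K] half_gt_zero by blast
  have bound: "finite I \<and> card I \<le> card k"
    if I: "f ` I \<subseteq> K" "\<forall>i\<in>I. \<forall>j\<in>I. i \<noteq> j \<longrightarrow> \<delta> \<le> dist (f i) (f j)" for I :: "'b set" and f
  proof -
    define c where "c i = (SOME x. x \<in> k \<and> dist x (f i) < \<delta> / 2)" for i
    have c: "c i \<in> k \<and> dist (c i) (f i) < \<delta> / 2" if "i \<in> I" for i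
    proof -
      have "\<exists>x. x \<in> k \<and> dist x (f i) < \<delta> / 2"
        using I(1) k(2) that by fastforce
      then show ?thesis unfolding c_def by (rule someI_ex)
    qed
    have "inj_on c I"
    proof (rule inj_onI, rule ccontr)
      fix i j assume ij: "i \<in> I" "j \<in> I" "c i = c j" "i \<noteq> j"
      have "dist (f i) (f j) < \<delta>"
        using dist_triangle_half_r[of "c i" "f i" \<delta> "f j"] c[OF ij(1)] c[OF ij(2)] ij(3) by simp
      with I(2) ij show False by fastforce
    qed
    moreover have "c ` I \<subseteq> k" using c by auto
    ultimately show ?thesis
      using k(1) by (meson card_inj_on_le inj_on_finite)
  qed
  show ?thesis by (intro exI[of _ "card k"] allI impI, elim conjE) (rule bound)
qed

text \<open>The similarities enter only through their contraction ratios, so \<open>\<rho>\<close> is a parameter, and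
  \<open>word_weight \<rho> w\<close> is the ratio of \<open>word_map s w\<close>.\<close>

locale open_set_ifs =
  fixes M :: nat and s :: "nat \<Rightarrow> 'a::heine_borel \<Rightarrow> 'a" and \<rho> :: "nat \<Rightarrow> real"
    and \<Gamma> U :: "'a set"
  assumes ratio_pos: "m \<in> {1..M} \<Longrightarrow> 0 < \<rho> m"
    and ratio_less_1: "m \<in> {1..M} \<Longrightarrow> \<rho> m < 1"
    and dist_map: "m \<in> {1..M} \<Longrightarrow> dist (s m x) (s m y) = \<rho> m * dist x y"
    and surj_map: "m \<in> {1..M} \<Longrightarrow> surj (s m)"
    and compact_attractor: "compact \<Gamma>"
    and attractor_eq: "\<Gamma> = (\<Union>m\<in>{1..M}. s m ` \<Gamma>)"
    and open_U: "open U" and U_nonempty: "U \<noteq> {}"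
    and U_subset: "m \<in> {1..M} \<Longrightarrow> s m ` U \<subseteq> U"
    and U_disjoint: "i \<in> {1..M} \<Longrightarrow> j \<in> {1..M} \<Longrightarrow> i \<noteq> j \<Longrightarrow> s i ` U \<inter> s j ` U = {}"
begin

lemma word_ratio_pos: "w \<in> words M \<Longrightarrow> 0 < word_weight \<rho> w"
  by (induction w) (auto simp: ratio_pos)

lemma word_ratio_le_1: "w \<in> words M \<Longrightarrow> word_weight \<rho> w \<le> 1"
proof (induction w)
  case (Cons m w)
  then show ?case
    using ratio_less_1[of m] word_ratio_pos[of w] ratio_pos[of m] by (simp add: mult_le_one)
qed simp

lemma nonempty_word_ratio_less_1:
  assumes "w \<in> words M" "w \<noteq> []"
  shows "word_weight \<rho> w < 1"
proof -
  obtain m v where w: "w = m # v" using assms(2) by (cases w) auto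
  then have "m \<in> {1..M}" "v \<in> words M" using assms(1) by simp_all
  then have "\<rho> m * word_weight \<rho> v \<le> \<rho> m * 1" "\<rho> m < 1"
    using ratio_pos[of m] ratio_less_1[of m] word_ratio_le_1[of v] by (auto intro: mult_left_mono)
  then show ?thesis by (simp add: w)
qed

lemma dist_word_map:
  "w \<in> words M \<Longrightarrow> dist (word_map s w x) (word_map s w y) = word_weight \<rho> w * dist x y"
  by (induction w) (auto simp: dist_map)

lemma bij_word_map: "w \<in> words M \<Longrightarrow> bij (word_map s w)"
proof (induction w)
  case (Cons m w)
  have "inj (s m)"
  proof (rule injI)
    fix x y assume "s m x = s m y"
    with dist_map[of m x y] ratio_pos[of m] Cons.prems show "x = y" by simp
  qed
  with Cons surj_map[of m] have "bij (s m)" "bij (word_map s w)" by (auto simp: bij_def)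
  then show ?case unfolding word_map_Cons by (rule bij_comp[rotated])
qed (simp add: bij_id)

lemma continuous_word_map:
  assumes "w \<in> words M"
  shows "continuous_on UNIV (word_map s w)"
proof (rule lipschitz_on_continuous_on)
  show "(word_weight \<rho> w)-lipschitz_on UNIV (word_map s w)"
    using assms by (intro lipschitz_onI) (auto simp: dist_word_map word_ratio_pos less_imp_le)
qed

lemma word_map_subset:
  assumes "w \<in> words M" "\<And>m. m \<in> {1..M} \<Longrightarrow> s m ` A \<subseteq> A"
  shows "word_map s w ` A \<subseteq> A"
  using assms
proof (induction w)
  case (Cons m w)
  then have "word_map s w ` A \<subseteq> A" "s m ` A \<subseteq> A" by simp_all
  then show ?case unfolding word_map_Cons image_comp[symmetric] by blast
qed simp

lemma attractor_subset: "m \<in> {1..M} \<Longrightarrow> s m ` \<Gamma> \<subseteq> \<Gamma>"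
  using attractor_eq by blast

lemma cylinder_mono:
  assumes "u \<in> words M"
  shows "word_map s (v @ u) ` \<Gamma> \<subseteq> word_map s v ` \<Gamma>"
  unfolding word_map_append image_comp[symmetric]
  by (intro image_mono word_map_subset assms attractor_subset)

lemma compact_cylinder: "w \<in> words M \<Longrightarrow> compact (word_map s w ` \<Gamma>)"
  by (meson compact_attractor compact_continuous_image continuous_on_subset continuous_word_map
      subset_UNIV)

lemma parallel_words_disjoint:
  assumes "parallel v v'" "v \<in> words M" "v' \<in> words M"
  shows "word_map s v ` U \<inter> word_map s v' ` U = {}"
proof -
  obtain u i w j w' where dec: "i \<noteq> j" "v = u @ i # w" "v' = u @ j # w'"
    using parallel_decomp[OF assms(1)] by blast
  have mem: "u \<in> words M" "i \<in> {1..M}" "j \<in> {1..M}" "w \<in> words M" "w' \<in> words M"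
    using assms dec by auto
  have "s i ` word_map s w ` U \<inter> s j ` word_map s w' ` U = {}"
    using U_disjoint[OF mem(2,3) dec(1)] word_map_subset[OF mem(4) U_subset]
      word_map_subset[OF mem(5) U_subset] by blast
  then have "word_map s u ` (s i ` word_map s w ` U) \<inter> word_map s u ` (s j ` word_map s w' ` U) = {}"
    by (metis bij_word_map[OF mem(1)] bij_is_inj image_Int image_empty)
  then show ?thesis
    by (simp add: dec word_map_append image_comp comp_assoc)
qed

text \<open>The condition on \<open>butlast v\<close> makes \<open>v\<close> the shortest word along its code whose ratio does not
  exceed that of \<open>w\<close>; the cylinders of neighbours are thus comparable in size to that of \<open>w\<close>.\<close>

definition neighbours :: "nat list \<Rightarrow> nat list set" where
  "neighbours w = {v \<in> words M. word_weight \<rho> v \<le> word_weight \<rho> w \<and>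
     (v = [] \<or> word_weight \<rho> w < word_weight \<rho> (butlast v)) \<and>
     word_map s v ` \<Gamma> \<inter> word_map s w ` \<Gamma> \<noteq> {}}"

text \<open>Extending a word lowers its ratio, so a proper prefix of a neighbour still has ratio above
  that of \<open>w\<close>. Distinct neighbours are therefore parallel, which makes their
  copies of \<open>U\<close> disjoint.\<close>

lemma neighbours_antichain:
  assumes "v \<in> neighbours w" "v' \<in> neighbours w" "prefix v v'"
  shows "v = v'"
proof (rule ccontr)
  assume "v \<noteq> v'"
  with assms(3) have ne: "v' \<noteq> []" and "prefix v (butlast v')"
    by (auto simp: prefix_def butlast_append)
  then obtain u where u: "butlast v' = v @ u" by (auto simp: prefix_def)
  have v': "v' = butlast v' @ [last v']" using ne by simp
  have "v \<in> words M" "u \<in> words M"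
    using assms(2) v' u unfolding neighbours_def by (metis (no_types, lifting) mem_Collect_eq words_simps(3))+
  then have "word_weight \<rho> (butlast v') \<le> word_weight \<rho> v"
    unfolding u using word_ratio_le_1[of u] word_ratio_pos[of v] by (simp add: mult_left_le)
  with assms ne show False by (auto simp: neighbours_def)
qed

text \<open>A packing argument. Fix a ball in \<open>U\<close> with centre \<open>a\<close>. The points
  \<open>word_map s v a\<close>, for neighbours \<open>v\<close> of \<open>w\<close>, lie within a constant times the ratio of
  \<open>w\<close> from the cylinder of \<open>w\<close>. Their mutual distances are at least another constant times this ratio,
  because the images of the ball are disjoint. Applying the inverse of \<open>word_map s w\<close> turns them into uniformly separated points of a fixed ball.\<close>

lemma card_neighbours_bounded:
  "\<exists>N. \<forall>w\<in>words M. finite (neighbours w) \<and> card (neighbours w) \<le> N"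
proof -
  obtain a \<epsilon> where a: "a \<in> U" "0 < \<epsilon>" "ball a \<epsilon> \<subseteq> U"
    using U_nonempty open_U by (meson all_not_in_conv openE)
  \<comment> \<open>The element 1 guarantees \<open>c \<le> 1\<close>, which serves when the empty word is a neighbour.\<close>
  define c where "c = Min (insert 1 (\<rho> ` {1..M}))"
  have c: "0 < c" "c \<le> 1" "\<And>m. m \<in> {1..M} \<Longrightarrow> c \<le> \<rho> m"
    using ratio_pos unfolding c_def by (auto intro: Min_le simp del: Min_insert)
  obtain D where D: "\<And>g. g \<in> \<Gamma> \<Longrightarrow> dist a g \<le> D"
    using compact_imp_bounded[OF compact_attractor] bounded_any_center[of \<Gamma> a] by auto
  obtain N where N: "\<And>(I :: nat list set) f. f ` I \<subseteq> cball a (2 * D) \<Longrightarrow>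
      (\<forall>i\<in>I. \<forall>j\<in>I. i \<noteq> j \<longrightarrow> c * \<epsilon> \<le> dist (f i) (f j)) \<Longrightarrow> finite I \<and> card I \<le> N"
    using separated_subset_card_bound[OF compact_cball[of a "2 * D"], of "c * \<epsilon>"] a(2) c(1)
    by (metis mult_pos_pos)
  have "finite (neighbours w) \<and> card (neighbours w) \<le> N" if w: "w \<in> words M" for w
  proof -
    define f where "f v = inv (word_map s w) (word_map s v a)" for v
    have sf: "word_map s w (f v) = word_map s v a" for v
      using bij_word_map[OF w] by (simp add: f_def bij_is_surj surj_f_inv_f)
    have rw: "0 < word_weight \<rho> w" using word_ratio_pos[OF w] .
    have lower: "c * word_weight \<rho> w \<le> word_weight \<rho> v" if v: "v \<in> neighbours w" for v
    proof (cases "v = []")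
      case True
      with v c(1,2) word_ratio_le_1[OF w] rw show ?thesis
        by (simp add: mult_le_one)
    next
      case False
      then obtain v0 m where v0: "v = v0 @ [m]" by (metis append_butlast_last_id)
      with v have "word_weight \<rho> w < word_weight \<rho> v0" "m \<in> {1..M}" by (auto simp: neighbours_def)
      with c(3) ratio_pos[of m] rw have "c * word_weight \<rho> w \<le> \<rho> m * word_weight \<rho> v0"
        by (intro mult_mono) auto
      then show ?thesis by (simp add: v0 mult.commute)
    qed
    have "f ` neighbours w \<subseteq> cball a (2 * D)"
    proof
      fix z assume "z \<in> f ` neighbours w"
      then obtain v where v: "v \<in> neighbours w" "z = f v" by auto
      then obtain g h where gh: "g \<in> \<Gamma>" "h \<in> \<Gamma>" "word_map s v g = word_map s w h"
        by (auto simp: neighbours_def)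
      have v': "v \<in> words M" "word_weight \<rho> v \<le> word_weight \<rho> w"
        using v by (auto simp: neighbours_def)
      have "word_weight \<rho> w * dist z h = dist (word_map s v a) (word_map s v g)"
        by (metis dist_word_map[OF w] sf v(2) gh(3))
      also have "\<dots> = word_weight \<rho> v * dist a g" by (simp add: dist_word_map v')
      also have "\<dots> \<le> word_weight \<rho> w * D"
        using v'(2) D[OF gh(1)] rw by (intro mult_mono) auto
      finally have "dist z h \<le> D" using rw by simp
      then show "z \<in> cball a (2 * D)"
        using D[OF gh(2)] dist_triangle2[of a z h] by simp
    qed
    moreover have "c * \<epsilon> \<le> dist (f v) (f v')"
      if v: "v \<in> neighbours w" "v' \<in> neighbours w" "v \<noteq> v'" for v v'
    proof -
      have mem: "v \<in> words M" "v' \<in> words M" using v by (auto simp: neighbours_def)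
      have "parallel v v'" using neighbours_antichain v by blast
      then have "word_map s v' a \<notin> word_map s v ` U"
        using parallel_words_disjoint[OF _ mem] a(1) by blast
      moreover obtain b where b: "word_map s v b = word_map s v' a"
        using bij_word_map[OF mem(1)] by (metis bij_pointE)
      ultimately have "b \<notin> ball a \<epsilon>" using a(3) by (metis image_eqI subsetD)
      then have "\<epsilon> \<le> dist a b" by simp
      then have "c * word_weight \<rho> w * \<epsilon> \<le> word_weight \<rho> v * dist a b"
        using lower[OF v(1)] a(2) word_ratio_pos[OF mem(1)] by (intro mult_mono) auto
      also have "\<dots> = word_weight \<rho> w * dist (f v) (f v')"
        by (metis dist_word_map[OF w] dist_word_map[OF mem(1)] sf b)
      finally show ?thesis using rw by (simp add: mult.commute mult.left_commute)
    qed
    ultimately show ?thesis by (intro N[of f "neighbours w"] ballI impI)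
  qed
  then show ?thesis by blast
qed

text \<open>The neighbours of a nonempty \<open>w\<close> are nonempty, as their ratios are below 1. For them \<open>butlast\<close>
  commutes with prepending \<open>u\<close>, and all ratios are just multiplied by that of \<open>u\<close>.\<close>

lemma append_neighbours:
  assumes "u \<in> words M" "w \<in> words M" "w \<noteq> []"
  shows "(@) u ` neighbours w \<subseteq> neighbours (u @ w)"
proof
  fix z assume "z \<in> (@) u ` neighbours w"
  then obtain v where v: "v \<in> neighbours w" "z = u @ v" by auto
  have "word_weight \<rho> w < 1" using nonempty_word_ratio_less_1 assms(2,3) .
  with v have "v \<noteq> []" by (auto simp: neighbours_def)
  have "word_map s u ` (word_map s v ` \<Gamma> \<inter> word_map s w ` \<Gamma>) \<noteq> {}"
    using v by (simp add: neighbours_def)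
  then have "word_map s z ` \<Gamma> \<inter> word_map s (u @ w) ` \<Gamma> \<noteq> {}"
    unfolding v(2) word_map_append image_comp[symmetric] by blast
  with v assms \<open>v \<noteq> []\<close> word_ratio_pos[OF assms(1)] show "z \<in> neighbours (u @ w)"
    by (auto simp: neighbours_def butlast_append)
qed

text \<open>A point of a cylinder lies in a subcylinder cut off at any prescribed smaller size \<open>l\<close>:
  append letters one by one, following the point, until the ratio first drops to \<open>l\<close> or below.\<close>

lemma cylinder_refine:
  assumes "x \<in> word_map s v ` \<Gamma>" "v \<in> words M" "v \<noteq> []" "0 < l" "l < word_weight \<rho> (butlast v)"
  shows "\<exists>u\<in>words M. x \<in> word_map s (v @ u) ` \<Gamma> \<and> word_weight \<rho> (v @ u) \<le> l \<and>
           l < word_weight \<rho> (butlast (v @ u))"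
proof -
  define q where "q = Max (insert 0 (\<rho> ` {1..M}))"
  have q: "0 \<le> q" "q < 1" "\<And>m. m \<in> {1..M} \<Longrightarrow> \<rho> m \<le> q"
    using ratio_less_1 unfolding q_def by (auto intro: Max_ge simp del: Max_insert)
  obtain k where k: "q ^ k < l" using real_arch_pow_inv[OF assms(4) q(2)] by blast
  have small: "word_weight \<rho> u \<le> q ^ length u" if "u \<in> words M" for u
    using that
    by (induction u) (auto intro!: mult_mono q simp: word_ratio_pos less_imp_le)
  have "\<exists>u\<in>words M. x \<in> word_map s (v @ u) ` \<Gamma> \<and> word_weight \<rho> (v @ u) \<le> l \<and>
           l < word_weight \<rho> (butlast (v @ u))"
    if "x \<in> word_map s v ` \<Gamma>" "v \<in> words M" "v \<noteq> []" "l < word_weight \<rho> (butlast v)" for v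
    using that
  proof (induction "k - length v" arbitrary: v rule: less_induct)
    case less
    show ?case
    proof (cases "word_weight \<rho> v \<le> l")
      case True
      with less.prems show ?thesis by (intro bexI[of _ "[]"]) auto
    next
      case False
      have "length v < k"
      proof (rule ccontr)
        assume "\<not> length v < k"
        then have "q ^ length v \<le> q ^ k" using q by (intro power_decreasing) auto
        with small[OF less.prems(2)] k False show False by linarith
      qed
      obtain g where g: "g \<in> \<Gamma>" "x = word_map s v g" using less.prems by auto
      obtain m h where m: "m \<in> {1..M}" "h \<in> \<Gamma>" "g = s m h" using g(1) attractor_eq by blast
      have "\<exists>u\<in>words M. x \<in> word_map s ((v @ [m]) @ u) ` \<Gamma> \<and> word_weight \<rho> ((v @ [m]) @ u) \<le> l \<and>
           l < word_weight \<rho> (butlast ((v @ [m]) @ u))"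
        using \<open>length v < k\<close> False less.prems m g
        by (intro less.hyps) (auto simp: word_map_append)
      then obtain u where "u \<in> words M" "x \<in> word_map s (v @ m # u) ` \<Gamma>"
        "word_weight \<rho> (v @ m # u) \<le> l" "l < word_weight \<rho> (butlast (v @ m # u))"
        by auto
      with m show ?thesis by (intro bexI[of _ "m # u"]) auto
    qed
  qed
  with assms show ?thesis by blast
qed

text \<open>Take \<open>w\<close> with the largest number of neighbours. Prepending a word injects the neighbours of \<open>w\<close> into
  those of \<open>i # u @ w\<close>, and by maximality this injection is onto. A point common to the cylinder of
  \<open>i # u @ w\<close> and the first-level cylinder of \<open>j\<close> would yield, after refining the
  latter, a neighbour beginning with \<open>j\<close> instead of \<open>i\<close>.\<close>

lemma isolated_word_exists:
  assumes "1 \<le> M"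
  shows "\<exists>w\<in>words M. \<forall>u\<in>words M. \<forall>i\<in>{1..M}. \<forall>j\<in>{1..M}. i \<noteq> j \<longrightarrow>
           word_map s (i # u @ w) ` \<Gamma> \<inter> s j ` \<Gamma> = {}"
proof -
  obtain N where N: "\<And>w. w \<in> words M \<Longrightarrow> finite (neighbours w) \<and> card (neighbours w) \<le> N"
    using card_neighbours_bounded by blast
  have "[1] \<in> words M \<and> [1] \<noteq> []" using assms by simp
  then have "\<exists>w. (w \<in> words M \<and> w \<noteq> []) \<and>
      (\<forall>v. v \<in> words M \<and> v \<noteq> [] \<longrightarrow> card (neighbours v) \<le> card (neighbours w))"
    by (rule Lattices_Big.ex_has_greatest_nat[where b = "Suc N"]) (simp add: N less_Suc_eq_le)
  then obtain w where w: "w \<in> words M" "w \<noteq> []"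
    and max: "\<And>v. v \<in> words M \<Longrightarrow> v \<noteq> [] \<Longrightarrow> card (neighbours v) \<le> card (neighbours w)"
    by auto
  have isolated: "word_map s (i # u @ w) ` \<Gamma> \<inter> s j ` \<Gamma> = {}"
    if u: "u \<in> words M" and i: "i \<in> {1..M}" and j: "j \<in> {1..M}" and "i \<noteq> j" for u i j
  proof (rule ccontr)
    assume "word_map s (i # u @ w) ` \<Gamma> \<inter> s j ` \<Gamma> \<noteq> {}"
    then obtain x where x: "x \<in> word_map s (i # u @ w) ` \<Gamma>" "x \<in> word_map s [j] ` \<Gamma>" by auto
    let ?w = "(i # u) @ w"
    have mem: "i # u \<in> words M" "?w \<in> words M" using u i w by auto
    have "(@) (i # u) ` neighbours w = neighbours ?w"
    proof (rule card_seteq)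
      show "finite (neighbours ?w)" using N[OF mem(2)] by simp
      show "(@) (i # u) ` neighbours w \<subseteq> neighbours ?w" by (rule append_neighbours[OF mem(1) w])
      have "card ((@) (i # u) ` neighbours w) = card (neighbours w)"
        by (intro card_image inj_onI) simp
      then show "card (neighbours ?w) \<le> card ((@) (i # u) ` neighbours w)"
        using max[OF mem(2)] by simp
    qed
    moreover have "\<exists>v. j # v \<in> neighbours ?w"
    proof -
      have "word_weight \<rho> ?w < word_weight \<rho> (butlast [j])"
        using nonempty_word_ratio_less_1[OF mem(2)] by simp
      moreover have "[j] \<in> words M" "[j] \<noteq> []" using j by simp_all
      ultimately obtain v where v: "v \<in> words M" "x \<in> word_map s ([j] @ v) ` \<Gamma>"
        "word_weight \<rho> ([j] @ v) \<le> word_weight \<rho> ?w"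
        "word_weight \<rho> ?w < word_weight \<rho> (butlast ([j] @ v))"
        using cylinder_refine[OF x(2) _ _ word_ratio_pos[OF mem(2)]] by blast
      moreover have "x \<in> word_map s ?w ` \<Gamma>" using x(1) by simp
      ultimately have "[j] @ v \<in> neighbours ?w"
        unfolding neighbours_def using j by (intro CollectI conjI disjI2) (simp, assumption+, blast)
      then have "j # v \<in> neighbours ?w" by simp
      then show ?thesis ..
    qed
    ultimately obtain v where "j # v \<in> (@) (i # u) ` neighbours w" by blast
    with \<open>i \<noteq> j\<close> show False by auto
  qed
  show ?thesis using w(1) by (intro bexI[of _ w] ballI impI isolated)
qed

end

section \<open>Self-similar measures\<close>

lemma isometry_measurable: "is_isometry T \<Longrightarrow> T \<in> borel_measurable borel"
  by (auto simp: is_isometry_def intro!: borel_measurable_continuous_onI continuous_intros)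

lemma isometry_surj:
  assumes "is_isometry T"
  shows "surj T"
proof -
  obtain A d where T: "orthogonal_matrix A" "T = (\<lambda>x. A *v x + d)"
    using assms by (auto simp: is_isometry_def)
  have "T (transpose A *v (y - d)) = y" for y
    using T by (simp add: matrix_vector_mul_assoc orthogonal_matrix_def del: transpose_matrix_vector)
  then show ?thesis by (rule surjI)
qed

locale self_similar = open_set_ifs M s \<rho> \<Gamma> U
  for M :: nat and s :: "nat \<Rightarrow> real ^ 'n \<Rightarrow> real ^ 'n" and \<rho> \<Gamma> U +
  fixes p :: "nat \<Rightarrow> real" and \<mu> :: "(real ^ 'n) measure"
  assumes weights: "is_weights M p"
    and self_similar: "self_similar_measure M s \<Gamma> p \<mu>"
    and M_pos: "1 \<le> M"
begin

sublocale finite_measure \<mu>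
  using self_similar by (simp add: self_similar_measure_def)

lemma sets_eq_borel [measurable_cong, simp]: "sets \<mu> = sets borel"
  using self_similar by (simp add: self_similar_measure_def)

lemma space_eq_UNIV [simp]: "space \<mu> = UNIV"
  using sets_eq_imp_space_eq[OF sets_eq_borel] by simp

lemma weight_pos: "m \<in> {1..M} \<Longrightarrow> 0 < p m" and sum_weights: "(\<Sum>m=1..M. p m) = 1"
  using weights by (auto simp: is_weights_def)

lemma word_weight_pos: "w \<in> words M \<Longrightarrow> 0 < word_weight p w"
  by (induction w) (auto simp: weight_pos)

lemma measurable_word_map: "w \<in> words M \<Longrightarrow> word_map s w \<in> borel_measurable borel"
  by (intro borel_measurable_continuous_onI continuous_word_map)

lemma vimage_word_map_borel: "w \<in> words M \<Longrightarrow> E \<in> sets borel \<Longrightarrow> word_map s w -` E \<in> sets borel"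
  using measurable_sets_borel[OF measurable_word_map] by simp

lemma vimage_map_borel: "m \<in> {1..M} \<Longrightarrow> E \<in> sets borel \<Longrightarrow> s m -` E \<in> sets borel"
  using vimage_word_map_borel[of "[m]" E] by simp

lemma cylinder_borel: "w \<in> words M \<Longrightarrow> word_map s w ` \<Gamma> \<in> sets borel"
  by (simp add: compact_cylinder borel_compact)

lemma attractor_borel [measurable]: "\<Gamma> \<in> sets borel"
  using cylinder_borel[of "[]"] by simp

lemma measure_self_similar:
  assumes "E \<in> sets borel"
  shows "measure \<mu> E = (\<Sum>m=1..M. p m * measure \<mu> (s m -` E))"
proof -
  have "emeasure \<mu> E = (\<Sum>m=1..M. ennreal (p m) * emeasure \<mu> (s m -` E))"
    using self_similar assms by (simp add: self_similar_measure_def)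
  also have "\<dots> = (\<Sum>m=1..M. ennreal (p m * measure \<mu> (s m -` E)))"
    by (intro sum.cong) (auto simp: emeasure_eq_measure ennreal_mult weight_pos less_imp_le)
  also have "\<dots> = ennreal (\<Sum>m=1..M. p m * measure \<mu> (s m -` E))"
    by (intro sum_ennreal) (auto simp: weight_pos less_imp_le)
  finally show ?thesis
    unfolding emeasure_eq_measure
    by (subst (asm) ennreal_inj) (auto intro!: sum_nonneg mult_nonneg_nonneg simp: weight_pos less_imp_le)
qed

lemma AE_attractor: "AE x in \<mu>. x \<in> \<Gamma>"
proof (rule AE_I)
  show "emeasure \<mu> (- \<Gamma>) = 0" using self_similar by (simp add: self_similar_measure_def)
qed auto

lemma measure_Int_attractor: "E \<in> sets borel \<Longrightarrow> measure \<mu> (E \<inter> \<Gamma>) = measure \<mu> E"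
  using AE_attractor by (intro finite_measure_eq_AE) auto

text \<open>In terms of codes, \<open>E\<close> contains no point whose code has \<open>w\<close> as a block, and such codes have
  probability zero. Without codes: the family \<open>\<A>\<close> of all sets avoiding \<open>w\<close> in this way is closed under
  preimages by the maps \<open>s m\<close>. Expanding \<open>\<mu> F\<close> along the letters of \<open>w\<close>, the term belonging to \<open>w\<close> itself
  vanishes and the other weights sum to \<open>1 - word_weight p w\<close>. So any bound valid on the whole of \<open>\<A>\<close>
  improves by this factor, and iterating it forces measure zero.\<close>

lemma avoiding_word_null:
  assumes w: "w \<in> words M" and E: "E \<in> sets borel"
    and avoid: "\<And>u. u \<in> words M \<Longrightarrow> word_map s (u @ w) ` \<Gamma> \<inter> E = {}"
  shows "measure \<mu> E = 0"
proof -
  define \<A> where "\<A> = {E \<in> sets borel. \<forall>u\<in>words M. word_map s (u @ w) ` \<Gamma> \<inter> E = {}}"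
  have \<A>_borel: "F \<in> sets borel"
    and \<A>_avoids: "u \<in> words M \<Longrightarrow> word_map s (u @ w) ` \<Gamma> \<inter> F = {}" if "F \<in> \<A>" for F u
    using that by (simp_all add: \<A>_def)
  have \<A>_vimage: "s m -` F \<in> \<A>" if mF: "m \<in> {1..M}" "F \<in> \<A>" for m F
  proof -
    have "word_map s (u @ w) ` \<Gamma> \<inter> s m -` F = {}" if u: "u \<in> words M" for u
    proof -
      have "word_map s ((m # u) @ w) ` \<Gamma> \<inter> F = {}"
        using mF u by (intro \<A>_avoids) simp_all
      then show ?thesis by auto
    qed
    with mF show ?thesis by (simp add: \<A>_def vimage_map_borel)
  qed
  have null: "measure \<mu> (word_map s w -` F) = 0" if "F \<in> \<A>" for F
  proof -
    have "word_map s ([] @ w) ` \<Gamma> \<inter> F = {}" "F \<in> sets borel"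
      by (rule \<A>_avoids[OF that words_simps(1)], rule \<A>_borel[OF that])
    then have "word_map s w -` F \<inter> \<Gamma> = {}" by auto
    then show ?thesis
      using measure_Int_attractor[OF vimage_word_map_borel[OF w \<open>F \<in> sets borel\<close>]] by simp
  qed
  \<comment> \<open>Stated for an arbitrary word \<open>x\<close> so that the expansion proceeds by induction, one letter at a time.\<close>
  have step: "measure \<mu> F \<le> (1 - word_weight p x) * B"
    if B: "\<And>F. F \<in> \<A> \<Longrightarrow> measure \<mu> F \<le> B"
      and "x \<in> words M" "F \<in> \<A>" "measure \<mu> (word_map s x -` F) = 0" for B x F
    using that(2-)
  proof (induction x arbitrary: F)
    case Nil
    then show ?case by simp
  next
    case (Cons a x)
    have a: "a \<in> {1..M}" and F: "F \<in> sets borel" using Cons.prems by (simp_all add: \<A>_def)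
    have "measure \<mu> (s a -` F) \<le> (1 - word_weight p x) * B"
      using Cons.prems by (intro Cons.IH \<A>_vimage) (simp_all add: vimage_comp comp_def)
    then have "p a * measure \<mu> (s a -` F) \<le> p a * ((1 - word_weight p x) * B)"
      using weight_pos[OF a] by simp
    moreover have "(\<Sum>m\<in>{1..M} - {a}. p m * measure \<mu> (s m -` F)) \<le> (\<Sum>m\<in>{1..M} - {a}. p m * B)"
      using Cons.prems by (intro sum_mono mult_left_mono B \<A>_vimage) (auto simp: weight_pos less_imp_le)
    moreover have "(\<Sum>m\<in>{1..M} - {a}. p m * B) = (1 - p a) * B"
      using sum.remove[OF _ a, of p] sum_weights by (simp add: sum_distrib_right[symmetric])
    moreover have "measure \<mu> F =
        p a * measure \<mu> (s a -` F) + (\<Sum>m\<in>{1..M} - {a}. p m * measure \<mu> (s m -` F))"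
      unfolding measure_self_similar[OF F] by (intro sum.remove a) simp
    ultimately show ?case by (simp add: algebra_simps)
  qed
  have bound: "measure \<mu> F \<le> (1 - word_weight p w) ^ k * measure \<mu> UNIV" if "F \<in> \<A>" for k F
    using that
  proof (induction k arbitrary: F)
    case 0
    then show ?case by (simp add: \<A>_def finite_measure_mono)
  next
    case (Suc k)
    then have "measure \<mu> F \<le> (1 - word_weight p w) * ((1 - word_weight p w) ^ k * measure \<mu> UNIV)"
      using null w by (intro step)
    then show ?case by (simp add: mult.assoc)
  qed
  have "E \<in> \<A>" using E avoid by (simp add: \<A>_def)
  have "0 \<le> 1 - word_weight p w"
  proof -
    have "word_weight p w \<le> 1" using w
    proof (induction w)
      case (Cons m w)
      then have "p m < 1" "0 < p m" using weights unfolding is_weights_def by auto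
      with Cons word_weight_pos[of w] show ?case by (simp add: mult_le_one)
    qed simp
    then show ?thesis by simp
  qed
  then have "(\<lambda>k. (1 - word_weight p w) ^ k) \<longlonglongrightarrow> 0"
    using word_weight_pos[OF w] by (intro LIMSEQ_realpow_zero) simp_all
  then have "(\<lambda>k. (1 - word_weight p w) ^ k * measure \<mu> UNIV) \<longlonglongrightarrow> 0 * measure \<mu> UNIV"
    by (intro tendsto_mult tendsto_const)
  then have "measure \<mu> E \<le> 0 * measure \<mu> UNIV"
    by (rule LIMSEQ_le_const) (use bound[OF \<open>E \<in> \<A>\<close>] in auto)
  then show ?thesis by (simp add: measure_le_0_iff)
qed

lemma overlap_null:
  assumes i: "i \<in> {1..M}" and j: "j \<in> {1..M}" and "i \<noteq> j"
  shows "measure \<mu> (s i -` (s j ` \<Gamma>)) = 0"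
proof -
  obtain w where w: "w \<in> words M"
    and iso: "\<forall>u\<in>words M. \<forall>i\<in>{1..M}. \<forall>j\<in>{1..M}. i \<noteq> j \<longrightarrow>
           word_map s (i # u @ w) ` \<Gamma> \<inter> s j ` \<Gamma> = {}"
    using isolated_word_exists[OF M_pos] by (elim bexE)
  show ?thesis
  proof (rule avoiding_word_null[OF w])
    show "s i -` (s j ` \<Gamma>) \<in> sets borel"
      using vimage_map_borel[OF i] cylinder_borel[of "[j]"] j by simp
    show "word_map s (u @ w) ` \<Gamma> \<inter> s i -` (s j ` \<Gamma>) = {}" if u: "u \<in> words M" for u
    proof -
      have "word_map s (i # u @ w) ` \<Gamma> \<inter> s j ` \<Gamma> = {}" using iso assms u by simp
      then show ?thesis by auto
    qed
  qed
qed

text \<open>In the self-similarity equation for \<open>E \<inter> s j ` \<Gamma>\<close> every term but the one for \<open>j\<close> is an overlap.\<close>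

lemma measure_Int_first_level:
  assumes j: "j \<in> {1..M}" and E: "E \<in> sets borel"
  shows "measure \<mu> (E \<inter> s j ` \<Gamma>) = p j * measure \<mu> (s j -` E)"
proof -
  have sj: "s j ` \<Gamma> \<in> sets borel" using cylinder_borel[of "[j]"] j by simp
  have zero: "measure \<mu> (s m -` (E \<inter> s j ` \<Gamma>)) = 0" if m: "m \<in> {1..M}" "m \<noteq> j" for m
  proof -
    have "measure \<mu> (s m -` (E \<inter> s j ` \<Gamma>)) \<le> measure \<mu> (s m -` (s j ` \<Gamma>))"
      using vimage_map_borel[OF m(1) sj] by (intro finite_measure_mono) auto
    then show ?thesis using overlap_null[OF m(1) j m(2)] by (simp add: measure_le_0_iff)
  qed
  have "inj (s j)" using bij_word_map[of "[j]"] j by (simp add: bij_is_inj)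
  then have "s j -` (E \<inter> s j ` \<Gamma>) = s j -` E \<inter> \<Gamma>"
    by (auto dest: injD)
  then have self: "measure \<mu> (s j -` (E \<inter> s j ` \<Gamma>)) = measure \<mu> (s j -` E)"
    by (simp add: measure_Int_attractor[OF vimage_map_borel[OF j E]])
  have "measure \<mu> (E \<inter> s j ` \<Gamma>) = (\<Sum>m=1..M. p m * measure \<mu> (s m -` (E \<inter> s j ` \<Gamma>)))"
    using E sj by (intro measure_self_similar) auto
  also have "\<dots> = p j * measure \<mu> (s j -` (E \<inter> s j ` \<Gamma>)) +
      (\<Sum>m\<in>{1..M} - {j}. p m * measure \<mu> (s m -` (E \<inter> s j ` \<Gamma>)))"
    using j by (intro sum.remove) auto
  also have "(\<Sum>m\<in>{1..M} - {j}. p m * measure \<mu> (s m -` (E \<inter> s j ` \<Gamma>))) = 0"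
    using zero by (intro sum.neutral) auto
  finally show ?thesis by (simp only: self add_0_right)
qed

lemma measure_Int_cylinder:
  assumes "w \<in> words M" "E \<in> sets borel"
  shows "measure \<mu> (E \<inter> word_map s w ` \<Gamma>) = word_weight p w * measure \<mu> (word_map s w -` E)"
  using assms
proof (induction w arbitrary: E)
  case Nil
  then show ?case by (simp add: measure_Int_attractor)
next
  case (Cons j w)
  have j: "j \<in> {1..M}" and w: "w \<in> words M" using Cons.prems by simp_all
  have cyl: "word_map s (j # w) ` \<Gamma> \<in> sets borel" using cylinder_borel[OF Cons.prems(1)] .
  have "word_map s (j # w) ` \<Gamma> \<subseteq> s j ` \<Gamma>"
    using cylinder_mono[OF w, of "[j]"] by simp
  then have "E \<inter> word_map s (j # w) ` \<Gamma> = (E \<inter> word_map s (j # w) ` \<Gamma>) \<inter> s j ` \<Gamma>" by blast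
  then have "measure \<mu> (E \<inter> word_map s (j # w) ` \<Gamma>) =
      p j * measure \<mu> (s j -` (E \<inter> word_map s (j # w) ` \<Gamma>))"
    using measure_Int_first_level[OF j] Cons.prems(2) cyl by (metis sets.Int)
  also have "s j -` (E \<inter> word_map s (j # w) ` \<Gamma>) = s j -` E \<inter> word_map s w ` \<Gamma>"
  proof -
    have "inj (s j)" using bij_word_map[of "[j]"] j by (simp add: bij_is_inj)
    then show ?thesis by (auto dest: injD)
  qed
  also have "measure \<mu> (s j -` E \<inter> word_map s w ` \<Gamma>) =
      word_weight p w * measure \<mu> (word_map s w -` (s j -` E))"
    by (intro Cons.IH w vimage_map_borel j Cons.prems(2))
  finally show ?case by (simp add: vimage_comp comp_def)
qed

text \<open>The change of variables behind the theorem: \<open>\<mu>\<close> restricted to the cylinder of \<open>w\<close> is \<open>word_weight p w\<close>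
  times the image of \<open>\<mu>\<close> under \<open>word_map s w\<close>, and \<open>\<mu>\<close> is its own image under \<open>T\<close>.\<close>

lemma nn_integral_cylinder:
  assumes T: "is_isometry T" "invariant_under \<mu> T" and w: "w \<in> words M"
    and g[measurable]: "g \<in> borel_measurable borel"
  shows "(\<integral>\<^sup>+x\<in>word_map s w ` \<Gamma>. g x \<partial>\<mu>) =
    ennreal (word_weight p w) * (\<integral>\<^sup>+x. g (word_map s w (T x)) \<partial>\<mu>)"
proof -
  note [measurable] = measurable_word_map[OF w] cylinder_borel[OF w] isometry_measurable[OF T(1)]
  have inv: "distr \<mu> borel T = \<mu>"
  proof (rule measure_eqI)
    fix E assume "E \<in> sets (distr \<mu> borel T)"
    then have E[measurable]: "E \<in> sets borel" by simp
    have "T -` E \<in> sets \<mu>" using measurable_sets_borel[OF isometry_measurable[OF T(1)] E] by simp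
    then have "emeasure \<mu> (T ` (T -` E)) = emeasure \<mu> (T -` E)"
      using T(2) unfolding invariant_under_def by (rule bspec[rotated])
    then have "emeasure \<mu> E = emeasure \<mu> (T -` E)"
      unfolding surj_image_vimage_eq[OF isometry_surj[OF T(1)]] .
    then show "emeasure (distr \<mu> borel T) E = emeasure \<mu> E"
      by (simp add: emeasure_distr)
  qed simp
  have "density \<mu> (indicator (word_map s w ` \<Gamma>)) =
      scale_measure (ennreal (word_weight p w)) (distr \<mu> borel (word_map s w))"
  proof (rule measure_eqI)
    fix E assume "E \<in> sets (density \<mu> (indicator (word_map s w ` \<Gamma>)))"
    then have E[measurable]: "E \<in> sets borel" by simp
    have "emeasure (density \<mu> (indicator (word_map s w ` \<Gamma>))) E = emeasure \<mu> (E \<inter> word_map s w ` \<Gamma>)"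
      by (subst emeasure_density) (auto simp: indicator_inter_arith[symmetric] Int_commute)
    also have "\<dots> = ennreal (word_weight p w) * emeasure \<mu> (word_map s w -` E)"
      using measure_Int_cylinder[OF w E] word_weight_pos[OF w]
      by (simp add: emeasure_eq_measure ennreal_mult)
    finally show "emeasure (density \<mu> (indicator (word_map s w ` \<Gamma>))) E =
        emeasure (scale_measure (ennreal (word_weight p w)) (distr \<mu> borel (word_map s w))) E"
      by (simp add: emeasure_distr)
  qed simp
  then have "(\<integral>\<^sup>+x. g x \<partial>density \<mu> (indicator (word_map s w ` \<Gamma>))) =
      ennreal (word_weight p w) * (\<integral>\<^sup>+x. g (word_map s w x) \<partial>\<mu>)"
    by (simp add: nn_integral_scale_measure nn_integral_distr)
  also have "(\<integral>\<^sup>+x. g (word_map s w x) \<partial>\<mu>) = (\<integral>\<^sup>+x. g (word_map s w (T x)) \<partial>\<mu>)"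
    by (subst inv[symmetric]) (simp add: nn_integral_distr)
  finally show ?thesis
    by (subst (asm) nn_integral_density) (simp_all add: mult.commute)
qed

end

section \<open>The extended-real integral\<close>

lemma e2ennreal_cmult: "0 \<le> c \<Longrightarrow> e2ennreal (ereal c * a) = ennreal c * e2ennreal a"
  by (cases a; cases "c = 0") (simp_all add: ennreal_mult' ennreal_mult_top e2ennreal_neg)

lemma enn2ereal_cmult_diff:
  assumes "0 \<le> c"
  shows "enn2ereal (ennreal c * a) - enn2ereal (ennreal c * b) = ereal c * (enn2ereal a - enn2ereal b)"
  using assms
  by (cases a rule: ennreal_cases; cases b rule: ennreal_cases; cases "c = 0")
    (simp_all add: ennreal_mult[symmetric] ennreal_mult_top enn2ereal_ennreal algebra_simps)

lemma ext_integral_cmult: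
  assumes [measurable]: "f \<in> borel_measurable \<mu>" "B \<in> sets \<mu>" and "0 \<le> c"
  shows "ext_integral \<mu> B (\<lambda>x. ereal c * f x) = ereal c * ext_integral \<mu> B f"
proof -
  have "e2ennreal (- (ereal c * f x)) = ennreal c * e2ennreal (- f x)" for x
    using e2ennreal_cmult[OF \<open>0 \<le> c\<close>, of "- f x"] by simp
  then show ?thesis
    unfolding ext_integral_def enn2ereal_cmult_diff[OF \<open>0 \<le> c\<close>, symmetric]
    by (simp add: e2ennreal_cmult[OF \<open>0 \<le> c\<close>] mult.assoc nn_integral_cmult)
qed

lemma ext_integral_transport:
  assumes [measurable]: "f \<in> borel_measurable borel" and "0 \<le> c"
    and transport: "\<And>g :: 'a::topological_space \<Rightarrow> ennreal. g \<in> borel_measurable borel \<Longrightarrow>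
      (\<integral>\<^sup>+x\<in>B. g x \<partial>\<mu>) = ennreal c * (\<integral>\<^sup>+x. g (h x) \<partial>\<nu>)"
  shows "ext_integral \<mu> B f = ereal c * ext_integral \<nu> UNIV (\<lambda>x. f (h x))"
  unfolding ext_integral_def using \<open>0 \<le> c\<close>
  by (simp add: transport enn2ereal_cmult_diff)

lemma ext_integral_upper_bound:
  assumes "finite_measure \<mu>" and [measurable]: "f \<in> borel_measurable \<mu>"
    and "AE x in \<mu>. f x \<le> ereal C" "0 \<le> C"
  shows "(\<integral>\<^sup>+x. e2ennreal (f x) \<partial>\<mu>) \<le> ennreal (C * measure \<mu> (space \<mu>))"
    and "ext_integral \<mu> UNIV f \<le> ereal (C * measure \<mu> (space \<mu>))"
proof -
  interpret finite_measure \<mu> by fact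
  have "AE x in \<mu>. e2ennreal (f x) \<le> ennreal C"
    using assms(3) by eventually_elim (metis e2ennreal_mono e2ennreal_ereal)
  then have "(\<integral>\<^sup>+x. e2ennreal (f x) \<partial>\<mu>) \<le> (\<integral>\<^sup>+x. ennreal C \<partial>\<mu>)"
    by (rule nn_integral_mono_AE)
  also have "\<dots> = ennreal (C * measure \<mu> (space \<mu>))"
    using \<open>0 \<le> C\<close> by (simp add: emeasure_eq_measure ennreal_mult)
  finally show le: "(\<integral>\<^sup>+x. e2ennreal (f x) \<partial>\<mu>) \<le> ennreal (C * measure \<mu> (space \<mu>))" .
  have "ext_integral \<mu> UNIV f \<le> enn2ereal (\<integral>\<^sup>+x. e2ennreal (f x) \<partial>\<mu>)"
    unfolding ext_integral_def by (auto intro!: ereal_diff_le_self)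
  also have "\<dots> \<le> enn2ereal (ennreal (C * measure \<mu> (space \<mu>)))"
    using le by (simp add: less_eq_ennreal.rep_eq)
  also have "\<dots> = ereal (C * measure \<mu> (space \<mu>))"
    using \<open>0 \<le> C\<close> by (simp add: enn2ereal_ennreal)
  finally show "ext_integral \<mu> UNIV f \<le> ereal (C * measure \<mu> (space \<mu>))" .
qed

text \<open>The identity \<open>(c + a)\<^sup>+ - (c + a)\<^sup>- = (a\<^sup>+ - a\<^sup>-) + (c\<^sup>+ - c\<^sup>-)\<close> for positive and negative parts,
  rearranged to avoid subtraction, so that it can be integrated in \<open>ennreal\<close> without any
  finiteness condition.\<close>

lemma e2ennreal_add_parts:
  "e2ennreal (ereal c + a) + e2ennreal (- a) + ennreal (- c) =
   e2ennreal a + e2ennreal (- (ereal c + a)) + ennreal c"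
proof (cases a)
  case (real x)
  have pos: "ennreal y = ennreal (max 0 y)" for y by (simp add: max_def ennreal_neg)
  have "ennreal (max 0 (c + x)) + ennreal (max 0 (- x)) + ennreal (max 0 (- c)) =
      ennreal (max 0 x) + ennreal (max 0 (- (c + x))) + ennreal (max 0 c)"
    by (simp del: ennreal_plus add: ennreal_plus[symmetric] max_def)
  then show ?thesis unfolding real by (simp add: pos[symmetric])
qed simp_all

text \<open>The upper bound on \<open>f\<close> makes the integrals of the positive parts of \<open>f\<close> and \<open>c + f\<close> finite, which
  excludes \<open>\<infinity> - \<infinity>\<close>. Both sides may be \<open>-\<infinity>\<close>; this case is needed for the inner integral of the
  logarithmic kernel, which may diverge at some points.\<close>

lemma ext_integral_add_const:
  assumes "finite_measure \<mu>" and f[measurable]: "f \<in> borel_measurable \<mu>"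
    and bound: "AE x in \<mu>. f x \<le> ereal C" "0 \<le> C"
  shows "ext_integral \<mu> UNIV (\<lambda>x. ereal c + f x) =
    ereal (c * measure \<mu> (space \<mu>)) + ext_integral \<mu> UNIV f"
proof -
  interpret finite_measure \<mu> by fact
  define m where "m = measure \<mu> (space \<mu>)"
  have m: "0 \<le> m" by (simp add: m_def)
  define P N P' N' where "P = (\<integral>\<^sup>+x. e2ennreal (f x) \<partial>\<mu>)" and "N = (\<integral>\<^sup>+x. e2ennreal (- f x) \<partial>\<mu>)"
    and "P' = (\<integral>\<^sup>+x. e2ennreal (ereal c + f x) \<partial>\<mu>)"
    and "N' = (\<integral>\<^sup>+x. e2ennreal (- (ereal c + f x)) \<partial>\<mu>)"
  have const: "ennreal y * emeasure \<mu> (space \<mu>) = ennreal (max 0 y * m)" for y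
    by (cases "0 \<le> y") (simp_all add: m_def emeasure_eq_measure ennreal_mult max_def ennreal_neg)
  have "(\<integral>\<^sup>+x. e2ennreal (ereal c + f x) + e2ennreal (- f x) + ennreal (- c) \<partial>\<mu>) =
      (\<integral>\<^sup>+x. e2ennreal (f x) + e2ennreal (- (ereal c + f x)) + ennreal c \<partial>\<mu>)"
    by (simp only: e2ennreal_add_parts)
  then have balance: "P' + N + ennreal (max 0 (- c) * m) = P + N' + ennreal (max 0 c * m)"
    by (simp add: nn_integral_add const P_def N_def P'_def N'_def)
  have "P < \<infinity>"
    using ext_integral_upper_bound(1)[OF assms] by (auto simp: P_def intro: le_less_trans)
  moreover have "P' < \<infinity>"
  proof -
    have "AE x in \<mu>. ereal c + f x \<le> ereal (max 0 c + C)"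
      using bound(1)
    proof eventually_elim
      case (elim x)
      then have "ereal c + f x \<le> ereal (max 0 c) + ereal C" by (intro add_mono) auto
      then show ?case by (simp only: plus_ereal.simps)
    qed
    then have "P' \<le> ennreal ((max 0 c + C) * measure \<mu> (space \<mu>))"
      unfolding P'_def using \<open>0 \<le> C\<close>
      by (intro ext_integral_upper_bound(1)[OF assms(1)]) auto
    then show ?thesis by (rule le_less_trans) simp
  qed
  ultimately obtain a a' where a: "P = ennreal a" "0 \<le> a" "P' = ennreal a'" "0 \<le> a'"
    by (cases P rule: ennreal_cases; cases P' rule: ennreal_cases) auto
  have "enn2ereal P' - enn2ereal N' = ereal (c * m) + (enn2ereal P - enn2ereal N)"
  proof (cases N rule: ennreal_cases)
    case top
    with balance a m have "N' = \<infinity>"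
      by (cases N' rule: ennreal_cases) (simp_all del: ennreal_plus add: ennreal_plus[symmetric])
    with top a show ?thesis by (simp add: enn2ereal_ennreal)
  next
    case (real b)
    with balance a m obtain b' where b': "N' = ennreal b'" "0 \<le> b'"
      by (cases N' rule: ennreal_cases) (simp_all del: ennreal_plus add: ennreal_plus[symmetric])
    have "a' + b + max 0 (- c) * m = a + b' + max 0 c * m"
      using balance a real b' m by (simp del: ennreal_plus add: ennreal_plus[symmetric])
    then have "a' - b' = c * m + (a - b)"
      by (cases "0 \<le> c") (simp_all add: max_absorb1 max_absorb2 algebra_simps)
    with a real b' show ?thesis by (simp add: enn2ereal_ennreal)
  qed
  then show ?thesis
    by (simp add: ext_integral_def P_def N_def P'_def N'_def m_def)
qed

lemma ext_integral_measurable: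
  assumes "sigma_finite_measure \<nu>" and [measurable]: "case_prod f \<in> borel_measurable (N \<Otimes>\<^sub>M \<nu>)"
    "B \<in> sets \<nu>"
  shows "(\<lambda>x. ext_integral \<nu> B (f x)) \<in> borel_measurable N"
proof -
  interpret sigma_finite_measure \<nu> by fact
  show ?thesis unfolding ext_integral_def by measurable
qed

section \<open>The kernel and the sub-integrals\<close>

lemma kernel_measurable [measurable]:
  assumes [measurable]: "f \<in> borel_measurable N" "g \<in> borel_measurable N"
  shows "(\<lambda>x. kernel t (f x) (g x :: 'a::euclidean_space)) \<in> borel_measurable N"
proof -
  \<comment> \<open>Testing a real number for zero, rather than two vectors for equality, lets the measurability
    prover handle the case distinction.\<close>
  have "kernel t x y = (if norm (x - y) = 0 then (if t = 0 then -\<infinity> else \<infinity>)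
      else ereal (if t = 0 then ln (norm (x - y)) else norm (x - y) powr - t))" for x y :: 'a
    by (simp add: kernel_def)
  then show ?thesis by simp
qed

lemma kernel_0_le_norm: "kernel 0 x y \<le> ereal (norm (x - y))"
  using ln_less_self[of "norm (x - y)"] by (auto simp: kernel_def less_imp_le)

lemma kernel_scale:
  assumes "norm (x - y) = r * norm (x' - y')" "0 < r"
  shows "kernel 0 x y = ereal (ln r) + kernel 0 x' y'"
    and "t \<noteq> 0 \<Longrightarrow> kernel t x y = ereal (r powr - t) * kernel t x' y'"
proof -
  have "x = y \<longleftrightarrow> x' = y'" using assms by (metis mult_eq_0_iff norm_eq_zero eq_iff_diff_eq_0 less_irrefl)
  then show "kernel 0 x y = ereal (ln r) + kernel 0 x' y'"
    and "t \<noteq> 0 \<Longrightarrow> kernel t x y = ereal (r powr - t) * kernel t x' y'"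
    using assms by (simp_all add: kernel_def ln_mult powr_mult)
qed

text \<open>Extracts from the matrix form what the locale \<open>open_set_ifs\<close> asks for.\<close>

lemma contracting_similarity_metric:
  assumes "contracting_similarity f"
  shows "\<exists>\<rho>. 0 < \<rho> \<and> \<rho> < 1 \<and> (\<forall>x y. dist (f x) (f y) = \<rho> * dist x y) \<and> surj f"
proof -
  obtain \<rho> A d where f: "0 < \<rho>" "\<rho> < 1" "orthogonal_matrix A" "f = (\<lambda>x. \<rho> *\<^sub>R (A *v x) + d)"
    using assms by (auto simp: contracting_similarity_def)
  have "orthogonal_transformation ((*v) A)"
    using f(3) by (simp add: orthogonal_transformation_matrix)
  then have norm: "norm (A *v x) = norm x" for x
    by (rule orthogonal_transformation_norm)
  have "dist (f x) (f y) = \<rho> * dist x y" for x y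
  proof -
    have "f x - f y = \<rho> *\<^sub>R (A *v (x - y))"
      by (simp add: f(4) matrix_vector_mult_diff_distrib scaleR_diff_right)
    then show ?thesis using f(1) by (simp add: dist_norm norm)
  qed
  moreover have "surj f"
  proof (rule surjI)
    show "f (transpose A *v ((1 / \<rho>) *\<^sub>R (y - d))) = y" for y
      using f by (simp add: matrix_vector_mul_assoc orthogonal_matrix_def del: transpose_matrix_vector)
  qed
  ultimately show ?thesis using f(1,2) by (intro exI[of _ \<rho>]) simp
qed

text \<open>Both sides of the theorem are instances: the left one with the given \<open>T\<close> and \<open>T'\<close>, the right one with
  the identity in their place. After that only the kernels need comparing.\<close>

lemma sub_integral_pullback:
  assumes "self_similar M s \<rho> \<Gamma> U p \<mu>" "self_similar M s \<rho> \<Gamma> U p' \<mu>'"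
    and T: "is_isometry T" "invariant_under \<mu> T" and T': "is_isometry T'" "invariant_under \<mu>' T'"
    and w: "w \<in> words M" and w': "w' \<in> words M"
  shows "sub_integral s \<Gamma> \<mu> \<mu>' t w w' = ereal (word_weight p w * word_weight p' w') *
    ext_integral \<mu> UNIV (\<lambda>x. ext_integral \<mu>' UNIV
      (\<lambda>y. kernel t (word_map s w (T x)) (word_map s w' (T' y))))"
proof -
  interpret A: self_similar M s \<rho> \<Gamma> U p \<mu> by fact
  interpret B: self_similar M s \<rho> \<Gamma> U p' \<mu>' by fact
  note [measurable] = A.measurable_word_map[OF w] A.measurable_word_map[OF w']
    isometry_measurable[OF T(1)] isometry_measurable[OF T'(1)]
    B.cylinder_borel[OF w'] A.sets_eq_borel B.sets_eq_borel
  have inner: "ext_integral \<mu>' (word_map s w' ` \<Gamma>) (kernel t x) =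
      ereal (word_weight p' w') * ext_integral \<mu>' UNIV (\<lambda>y. kernel t x (word_map s w' (T' y)))" for x
    using B.word_weight_pos[OF w']
    by (intro ext_integral_transport B.nn_integral_cylinder T' w') (auto simp: less_imp_le)
  have outer: "(\<lambda>x. ext_integral \<mu>' (word_map s w' ` \<Gamma>) (kernel t x)) \<in> borel_measurable borel"
    by (intro ext_integral_measurable B.sigma_finite_measure_axioms) measurable
  have pulled: "(\<lambda>x. ext_integral \<mu>' UNIV (\<lambda>y. kernel t (word_map s w (T x)) (word_map s w' (T' y))))
      \<in> borel_measurable \<mu>"
    by (intro ext_integral_measurable B.sigma_finite_measure_axioms) measurable
  have "sub_integral s \<Gamma> \<mu> \<mu>' t w w' = ereal (word_weight p w) *
      ext_integral \<mu> UNIV (\<lambda>x. ext_integral \<mu>' (word_map s w' ` \<Gamma>) (kernel t (word_map s w (T x))))"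
    unfolding sub_integral_def using A.word_weight_pos[OF w]
    by (intro ext_integral_transport[OF outer] A.nn_integral_cylinder T w) (auto simp: less_imp_le)
  also have "\<dots> = ereal (word_weight p w) * (ereal (word_weight p' w') *
      ext_integral \<mu> UNIV (\<lambda>x. ext_integral \<mu>' UNIV
        (\<lambda>y. kernel t (word_map s w (T x)) (word_map s w' (T' y)))))"
    unfolding inner using B.word_weight_pos[OF w']
    by (subst ext_integral_cmult[OF pulled]) (auto simp: less_imp_le)
  finally show ?thesis by (simp add: mult.assoc[symmetric])
qed

theorem proposition3p2:
  fixes s :: "nat \<Rightarrow> real ^ 'n \<Rightarrow> real ^ 'n"
    and \<Gamma> :: "(real ^ 'n) set"
    and \<mu> \<mu>' :: "(real ^ 'n) measure"
    and p p' :: "nat \<Rightarrow> real"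
    and T T' :: "real ^ 'n \<Rightarrow> real ^ 'n"
    and w w' v v' :: "nat list"
    and M :: nat
    and t tstar r :: real
  assumes "similarity_ifs M s"
    and "open_set_condition M s"
    and "is_attractor M s \<Gamma>"
    and "is_weights M p" and "is_weights M p'"
    and "self_similar_measure M s \<Gamma> p \<mu>"
    and "self_similar_measure M s \<Gamma> p' \<mu>'"
    and "is_critical_exponent s \<Gamma> \<mu> \<mu>' tstar"
    and "w \<in> words M" and "w' \<in> words M" and "v \<in> words M" and "v' \<in> words M"
    and "is_isometry T" and "is_isometry T'"
    and "invariant_under \<mu> T" and "invariant_under \<mu>' T'"
    and "r > 0"
    and "\<And>x y. norm (word_map s w (T (inv (word_map s v) x))
                    - word_map s w' (T' (inv (word_map s v') y))) = r * norm (x - y)"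
    and "0 \<le> t" and "t < tstar"
  shows "sub_integral s \<Gamma> \<mu> \<mu>' t w w' =
    (if t = 0
     then ereal (word_weight p w * word_weight p' w') *
            (ereal (measure \<mu> \<Gamma> * measure \<mu>' \<Gamma> * ln r) +
             ereal (1 / (word_weight p v * word_weight p' v')) * sub_integral s \<Gamma> \<mu> \<mu>' 0 v v')
     else ereal (word_weight p w * word_weight p' w' / (word_weight p v * word_weight p' v')
                 * r powr - t) * sub_integral s \<Gamma> \<mu> \<mu>' t v v')"
proof -
  have "\<forall>m\<in>{1..M}. \<exists>\<rho>. 0 < \<rho> \<and> \<rho> < 1 \<and> (\<forall>x y. dist (s m x) (s m y) = \<rho> * dist x y) \<and> surj (s m)"
    using assms(1) by (auto simp: similarity_ifs_def intro: contracting_similarity_metric)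
  from bchoice[OF this] obtain \<rho> where \<rho>: "\<forall>m\<in>{1..M}. 0 < \<rho> m \<and> \<rho> m < 1 \<and>
      (\<forall>x y. dist (s m x) (s m y) = \<rho> m * dist x y) \<and> surj (s m)" by (elim exE)
  obtain U where U: "U \<noteq> {}" "open U" "(\<Union>m\<in>{1..M}. s m ` U) \<subseteq> U"
      "disjoint_family_on (\<lambda>m. s m ` U) {1..M}"
    using assms(2) unfolding open_set_condition_def by (elim exE conjE)
  have osc: "open_set_ifs M s \<rho> \<Gamma> U"
  proof
    from assms(3) show "compact \<Gamma>" unfolding is_attractor_def by (elim conjE)
    from assms(3) show "\<Gamma> = (\<Union>m\<in>{1..M}. s m ` \<Gamma>)" unfolding is_attractor_def by (elim conjE)
    show "open U" "U \<noteq> {}" by fact+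
    show "s m ` U \<subseteq> U" if "m \<in> {1..M}" for m using U(3) that by (meson UN_subset_iff)
    show "s i ` U \<inter> s j ` U = {}" if "i \<in> {1..M}" "j \<in> {1..M}" "i \<noteq> j" for i j
      using disjoint_family_onD[OF U(4) that] .
  qed (use \<rho> in simp_all)
  have "1 \<le> M" using assms(1) by (simp add: similarity_ifs_def)
  with osc assms have A: "self_similar M s \<rho> \<Gamma> U p \<mu>" and B: "self_similar M s \<rho> \<Gamma> U p' \<mu>'"
    by (auto intro!: self_similar.intro self_similar_axioms.intro)
  interpret A: self_similar M s \<rho> \<Gamma> U p \<mu> by (rule A)
  interpret B: self_similar M s \<rho> \<Gamma> U p' \<mu>' by (rule B)

  define h h' where "h = (\<lambda>x. word_map s w (T x))" and "h' = (\<lambda>y. word_map s w' (T' y))"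
  define k k' where "k = word_map s v" and "k' = word_map s v'"
  note [measurable] = A.measurable_word_map[OF assms(11), folded k_def]
    A.measurable_word_map[OF assms(12), folded k'_def]
    A.sets_eq_borel B.sets_eq_borel
  define G where "G = (\<lambda>u x. ext_integral \<mu>' UNIV (\<lambda>y. kernel u (k x) (k' y)))"
  define J where "J u = ext_integral \<mu> UNIV (G u)" for u
  have G_measurable: "G t \<in> borel_measurable \<mu>" for t
    unfolding G_def by (intro ext_integral_measurable B.sigma_finite_measure_axioms) measurable
  have kernel_measurable_k: "(\<lambda>y. kernel u (k x) (k' y)) \<in> borel_measurable \<mu>'" for u x
    by measurable
  have "is_isometry (\<lambda>x :: real ^ 'n. x)"
    unfolding is_isometry_def
    by (rule exI[of _ "mat 1"], rule exI[of _ 0]) (simp add: orthogonal_matrix_id)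
  then have id: "is_isometry (\<lambda>x :: real ^ 'n. x)"
    "invariant_under \<mu> (\<lambda>x. x)" "invariant_under \<mu>' (\<lambda>x. x)"
    by (simp_all add: invariant_under_def)
  have lhs: "sub_integral s \<Gamma> \<mu> \<mu>' t w w' = ereal (word_weight p w * word_weight p' w') *
      ext_integral \<mu> UNIV (\<lambda>x. ext_integral \<mu>' UNIV (\<lambda>y. kernel t (h x) (h' y)))"
    unfolding h_def h'_def using assms by (intro sub_integral_pullback[OF A B])
  have rhs: "sub_integral s \<Gamma> \<mu> \<mu>' u v v' = ereal (word_weight p v * word_weight p' v') * J u" for u
    unfolding J_def G_def k_def k'_def using assms id by (intro sub_integral_pullback[OF A B])
  have "word_weight p v \<noteq> 0" "word_weight p' v' \<noteq> 0"
    using A.word_weight_pos[OF assms(11)] B.word_weight_pos[OF assms(12)] by simp_all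
  then have J_eq: "J u = ereal (1 / (word_weight p v * word_weight p' v')) * sub_integral s \<Gamma> \<mu> \<mu>' u v v'" for u
    by (simp add: rhs mult.assoc[symmetric])
  \<comment> \<open>Evaluating the hypothesis at \<open>k x\<close> and \<open>k' y\<close> cancels the inverses.\<close>
  have scale: "norm (h x - h' y) = r * norm (k x - k' y)" for x y
    using assms(18)[of "k x" "k' y"] assms(11,12)
    by (simp add: h_def h'_def k_def k'_def A.bij_word_map bij_is_inj inv_f_f)

  show ?thesis
  proof (cases "t = 0")
    case False
    have "ext_integral \<mu>' UNIV (\<lambda>y. kernel t (h x) (h' y)) = ereal (r powr - t) * G t x" for x
      unfolding G_def kernel_scale(2)[OF scale \<open>r > 0\<close> False]
      by (intro ext_integral_cmult kernel_measurable_k) auto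
    then have "ext_integral \<mu> UNIV (\<lambda>x. ext_integral \<mu>' UNIV (\<lambda>y. kernel t (h x) (h' y))) =
        ereal (r powr - t) * J t"
      unfolding J_def using ext_integral_cmult[OF G_measurable, of UNIV "r powr - t" t] by simp
    then show ?thesis
      using False by (simp add: lhs J_eq mult.assoc[symmetric])
  next
    case True
    \<comment> \<open>The maps \<open>k\<close> and \<open>k'\<close> send the bounded attractor, which carries both measures, into itself, and
      the logarithm is at most the distance; this bounds the integrands from above.\<close>
    obtain R where R: "\<And>x. x \<in> \<Gamma> \<Longrightarrow> norm x \<le> R" "0 \<le> R"
      using compact_imp_bounded[OF A.compact_attractor] bounded_pos by (metis less_imp_le)
    have k_in: "k x \<in> \<Gamma>" "k' x \<in> \<Gamma>" if "x \<in> \<Gamma>" for x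
      using A.word_map_subset[OF _ A.attractor_subset] assms(11,12) that
      unfolding k_def k'_def by blast+
    have inner_bound: "AE y in \<mu>'. kernel 0 (k x) (k' y) \<le> ereal (norm (k x) + R)" for x
      using B.AE_attractor
    proof eventually_elim
      case (elim y)
      have "norm (k x - k' y) \<le> norm (k x) + R"
        using norm_triangle_ineq4[of "k x" "k' y"] R(1)[OF k_in(2)[OF elim]] by linarith
      then show ?case using kernel_0_le_norm[of "k x" "k' y"] by (meson ereal_less_eq(3) order_trans)
    qed
    have outer_bound: "AE x in \<mu>. G 0 x \<le> ereal ((R + R) * measure \<mu>' UNIV)"
      using A.AE_attractor
    proof eventually_elim
      case (elim x)
      have "G 0 x \<le> ereal ((norm (k x) + R) * measure \<mu>' (space \<mu>'))"
        unfolding G_def using R(2)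
        by (intro ext_integral_upper_bound(2) inner_bound B.finite_measure_axioms kernel_measurable_k) auto
      also have "\<dots> \<le> ereal ((R + R) * measure \<mu>' UNIV)"
        using R(1)[OF k_in(1)[OF elim]] by (simp add: mult_right_mono)
      finally show ?case .
    qed
    have "ext_integral \<mu>' UNIV (\<lambda>y. kernel 0 (h x) (h' y)) = ereal (ln r * measure \<mu>' UNIV) + G 0 x" for x
      unfolding G_def kernel_scale(1)[OF scale \<open>r > 0\<close>]
      by (subst ext_integral_add_const[OF B.finite_measure_axioms kernel_measurable_k inner_bound])
        (simp_all add: R(2))
    then have "ext_integral \<mu> UNIV (\<lambda>x. ext_integral \<mu>' UNIV (\<lambda>y. kernel 0 (h x) (h' y))) =
        ereal (ln r * measure \<mu>' UNIV * measure \<mu> UNIV) + J 0"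
      using ext_integral_add_const[OF A.finite_measure_axioms G_measurable outer_bound] R(2)
      by (simp add: J_def)
    moreover have "measure \<mu> \<Gamma> = measure \<mu> UNIV" "measure \<mu>' \<Gamma> = measure \<mu>' UNIV"
      using A.measure_Int_attractor[of UNIV] B.measure_Int_attractor[of UNIV] by simp_all
    moreover have "ln r * measure \<mu>' UNIV * measure \<mu> UNIV = measure \<mu> UNIV * measure \<mu>' UNIV * ln r"
      by simp
    ultimately show ?thesis
      using True lhs by (simp add: J_eq[symmetric])
  qed
qed

end
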